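(* Let $H_1$ and $H_2$ be graphs each having at least one edge and let $p\in(0,1)$ satisfy $p^{e(H_1)}=(1-p)^{e(H_2)}$. Then $c(H_1,H_2)\le 2p^{e(H_1)}=2(1-p)^{e(H_2)}$, with equality if and only if $(H_1,H_2)$ is $(p,1-p)$-common.
   Context: $e(H)$ is the number of edges of $H$. A graphon is a measurable symmetric function $W:[0,1]^2\to[0,1]$; for a graph $H$, $t(H,W):=\int_{[0,1]^{V(H)}}\prod_{uv\in E(H)}W(x_u,x_v)\prod_{v\in V(H)}dx_v$; for a finite graph $G$, $t(H,G)$ is the probability a uniformly random map $V(H)\to V(G)$ is a homomorphism. Let $G_1,G_2,\dots$ be a sequence containing every finite graph exactly once; $\overline{G}$ is the complement. For $\lambda\in[0,2]$, $c_\lambda(H_1,H_2):=\liminf_{n\to\infty}[\lambda\, t(H_1,G_n)+(2-\lambda)\, t(H_2,\overline{G_n})]$ and $c(H_1,H_2):=\sup_{\lambda\in[0,2]}c_\lambda(H_1,H_2)$. For $p\in(0,1)$, the pair $(H_1,H_2)$ is $(p,1-p)$-common if for every graphon $W$, \[\frac{t(H_1,W)}{e(H_1)p^{e(H_1)-1}}+\frac{t(H_2,1-W)}{e(H_2)(1-p)^{e(H_2)-1}}\ge\frac{p}{e(H_1)}+\frac{1-p}{e(H_2)}.\] *)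

theory Defs
  imports "HOL-Probability.Probability" "HOL-Library.Ramsey"
begin

datatype 'a ugraph = Graph (verts: "'a set") (edges: "'a set set")

text \<open>Simple undirected graphs: an edge is a two-element set of vertices.  As usual a finite
  graph has at least one vertex, so that there is a uniformly random map into its vertex set.\<close>

definition fin_graph :: "'a ugraph \<Rightarrow> bool" where
  "fin_graph H \<longleftrightarrow> finite (verts H) \<and> verts H \<noteq> {} \<and> edges H \<subseteq> nsets (verts H) 2"

definition num_edges :: "'a ugraph \<Rightarrow> nat" where
  "num_edges H = card (edges H)"

definition complement :: "'a ugraph \<Rightarrow> 'a ugraph" where
  "complement G = Graph (verts G) (nsets (verts G) 2 - edges G)"

definition graph_iso :: "'a ugraph \<Rightarrow> 'b ugraph \<Rightarrow> bool" where
  "graph_iso G H \<longleftrightarrow>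
     (\<exists>f. bij_betw f (verts G) (verts H) \<and> (\<lambda>e. f ` e) ` edges G = edges H)"

text \<open>Graphs are counted up to isomorphism.  Every finite graph has an isomorphic copy with
  vertices in \<^typ>\<open>nat\<close>.\<close>

definition enumerates_finite_graphs :: "(nat \<Rightarrow> nat ugraph) \<Rightarrow> bool" where
  "enumerates_finite_graphs G \<longleftrightarrow>
     (\<forall>n. fin_graph (G n)) \<and> (\<forall>H :: nat ugraph. fin_graph H \<longrightarrow> (\<exists>!n. graph_iso (G n) H))"

definition is_hom :: "'a ugraph \<Rightarrow> 'b ugraph \<Rightarrow> ('a \<Rightarrow> 'b) \<Rightarrow> bool" where
  "is_hom H G f \<longleftrightarrow> f \<in> verts H \<rightarrow> verts G \<and> (\<forall>e\<in>edges H. f ` e \<in> edges G)"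

definition hom_density :: "'a ugraph \<Rightarrow> 'b ugraph \<Rightarrow> real" where
  "hom_density H G =
     measure_pmf.prob (pmf_of_set (verts H \<rightarrow>\<^sub>E verts G)) {f. is_hom H G f}"

definition unit_space :: "real measure" where
  "unit_space = restrict_space lborel {0..1}"

text \<open>Only the values on the unit square matter.  Measurability is Borel measurability.\<close>

definition graphon :: "(real \<Rightarrow> real \<Rightarrow> real) \<Rightarrow> bool" where
  "graphon W \<longleftrightarrow>
     (\<lambda>(x, y). W x y) \<in> borel_measurable (unit_space \<Otimes>\<^sub>M unit_space) \<and>
     (\<forall>x\<in>{0..1}. \<forall>y\<in>{0..1}. W x y = W y x \<and> 0 \<le> W x y \<and> W x y \<le> 1)"

text \<open>An arbitrary ordering of the two endpoints of an edge; it is irrelevant where it is used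
  below, because graphons are symmetric.\<close>

definition endpoints :: "'a set \<Rightarrow> 'a \<times> 'a" where
  "endpoints e = (SOME uv. e = {fst uv, snd uv})"

definition graphon_density :: "'a ugraph \<Rightarrow> (real \<Rightarrow> real \<Rightarrow> real) \<Rightarrow> real" where
  "graphon_density H W =
     (\<integral>x. (\<Prod>e\<in>edges H. case endpoints e of (u, v) \<Rightarrow> W (x u) (x v))
        \<partial>(\<Pi>\<^sub>M v\<in>verts H. unit_space))"

text \<open>The constants are \<^typ>\<open>ereal\<close>-valued only because \<^const>\<open>liminf\<close> and \<^const>\<open>Sup\<close>
  live in complete lattices; all values lie between 0 and 2.\<close>

definition c_lam ::
    "(nat \<Rightarrow> nat ugraph) \<Rightarrow> real \<Rightarrow> 'a ugraph \<Rightarrow> 'b ugraph \<Rightarrow> ereal" where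
  "c_lam G l H1 H2 =
     liminf (\<lambda>n. ereal (l * hom_density H1 (G n) + (2 - l) * hom_density H2 (complement (G n))))"

definition c_sup :: "(nat \<Rightarrow> nat ugraph) \<Rightarrow> 'a ugraph \<Rightarrow> 'b ugraph \<Rightarrow> ereal" where
  "c_sup G H1 H2 = (SUP l\<in>{0..2}. c_lam G l H1 H2)"

text \<open>The property of being $(p, 1-p)$-common.\<close>

definition common :: "real \<Rightarrow> 'a ugraph \<Rightarrow> 'b ugraph \<Rightarrow> bool" where
  "common p H1 H2 \<longleftrightarrow>
     (\<forall>W. graphon W \<longrightarrow>
        graphon_density H1 W / (real (num_edges H1) * p ^ (num_edges H1 - 1))
        + graphon_density H2 (\<lambda>x y. 1 - W x y)
            / (real (num_edges H2) * (1 - p) ^ (num_edges H2 - 1))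
        \<ge> p / real (num_edges H1) + (1 - p) / real (num_edges H2))"

lemma graph_iso_refl: "graph_iso G G"
  unfolding graph_iso_def by (intro exI[of _ id]) auto

lemma graph_iso_trans:
  assumes "graph_iso G H" "graph_iso H K" shows "graph_iso G K"
proof -
  obtain f where f: "bij_betw f (verts G) (verts H)" "(\<lambda>e. f ` e) ` edges G = edges H"
    using assms(1) unfolding graph_iso_def by blast
  obtain g where g: "bij_betw g (verts H) (verts K)" "(\<lambda>e. g ` e) ` edges H = edges K"
    using assms(2) unfolding graph_iso_def by blast
  have "(\<lambda>e. (g \<circ> f) ` e) ` edges G = (\<lambda>e. g ` e) ` ((\<lambda>e. f ` e) ` edges G)"
    by (simp add: image_image image_comp)
  then show ?thesis
    unfolding graph_iso_def using bij_betw_trans[OF f(1) g(1)] f(2) g(2) by metis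
qed

lemma graph_iso_sym:
  assumes "fin_graph G" "graph_iso G H" shows "graph_iso H G"
proof -
  obtain f where f: "bij_betw f (verts G) (verts H)" "(\<lambda>e. f ` e) ` edges G = edges H"
    using assms(2) unfolding graph_iso_def by blast
  let ?g = "inv_into (verts G) f"
  have "?g ` f ` e = e" if "e \<in> edges G" for e
    using that assms(1) f(1) unfolding fin_graph_def nsets_def bij_betw_def
    by (intro inv_into_image_cancel) auto
  then have "(\<lambda>e. ?g ` e) ` edges H = edges G"
    unfolding f(2)[symmetric] by (simp add: image_image)
  then show ?thesis
    unfolding graph_iso_def using bij_betw_inv_into[OF f(1)] by blast
qed

lemma countable_fin_graphs: "countable {H :: nat ugraph. fin_graph H}"
proof -
  let ?dec = "\<lambda>(vs, es :: nat list list). Graph (set vs) (set (map set es))"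
  have "H \<in> range ?dec" if H: "fin_graph H" for H :: "nat ugraph"
  proof -
    have fin: "finite (edges H)" "\<And>e. e \<in> edges H \<Longrightarrow> finite e"
      using H finite_subset[OF _ finite_imp_finite_nsets]
      unfolding fin_graph_def nsets_def by blast+
    obtain vs where vs: "set vs = verts H"
      using H finite_list unfolding fin_graph_def by blast
    obtain E where E: "set E = edges H" using fin(1) finite_list by blast
    have "set (map set (map sorted_list_of_set E)) = edges H"
      using E fin(2) by (force simp: image_iff)
    then have "H = ?dec (vs, map sorted_list_of_set E)"
      using vs by (cases H) (simp del: set_map)
    then show ?thesis by blast
  qed
  then have "{H :: nat ugraph. fin_graph H} \<subseteq> range ?dec" by blast
  then show ?thesis by (rule countable_subset) simp
qed

text \<open>The hypothesis on the sequence of graphs is satisfiable.\<close>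

lemma enumerates_finite_graphs_exists: "\<exists>G. enumerates_finite_graphs G"
proof -
  define rep where "rep H = (SOME K :: nat ugraph. fin_graph K \<and> graph_iso K H)"
    for H :: "nat ugraph"
  have rep: "fin_graph (rep H) \<and> graph_iso (rep H) H" if "fin_graph H" for H
    unfolding rep_def by (rule someI[of _ H]) (simp add: that graph_iso_refl)
  have rep_eq: "rep H = rep K" if "fin_graph H" "fin_graph K" "graph_iso H K" for H K
  proof -
    have "graph_iso L H \<longleftrightarrow> graph_iso L K" for L :: "nat ugraph"
      using that graph_iso_trans graph_iso_sym by blast
    then show ?thesis unfolding rep_def by simp
  qed
  let ?R = "rep ` {H. fin_graph H}"
  have ctb: "countable ?R" using countable_fin_graphs by simp
  have "infinite ?R"
  proof
    assume fin: "finite ?R"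
    define D where "D n = Graph {..n} {}" for n :: nat
    have D: "fin_graph (D n)" for n by (auto simp: D_def fin_graph_def)
    have "card (verts (rep (D n))) = Suc n" for n
    proof -
      have "card (verts (rep (D n))) = card (verts (D n))"
        using rep[OF D[of n]] bij_betw_same_card unfolding graph_iso_def by blast
      then show ?thesis by (simp add: D_def)
    qed
    then have "inj (\<lambda>n. rep (D n))" by (auto intro!: injI dest: arg_cong[of _ _ "\<lambda>K. card (verts K)"])
    moreover have "range (\<lambda>n. rep (D n)) \<subseteq> ?R" using D by blast
    ultimately show False using fin finite_subset range_inj_infinite by blast
  qed
  then have bij: "bij_betw (from_nat_into ?R) UNIV ?R"
    using ctb by (rule bij_betw_from_nat_into[rotated])
  define G where "G = from_nat_into ?R"
  have inj: "inj G" and ran: "range G = ?R"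
    using bij unfolding bij_betw_def G_def by simp_all
  have from_range: "\<exists>K. fin_graph K \<and> G n = rep K" for n
  proof -
    have "G n \<in> ?R" unfolding ran[symmetric] by (rule rangeI)
    then show ?thesis by (elim imageE) auto
  qed
  have "fin_graph (G n)" for n
    using from_range[of n] rep by auto
  moreover have "\<exists>!n. graph_iso (G n) H" if H: "fin_graph H" for H :: "nat ugraph"
  proof (rule ex_ex1I)
    have "rep H \<in> range G" unfolding ran using H by simp
    then obtain n where "rep H = G n" by (elim rangeE)
    then show "\<exists>n. graph_iso (G n) H" using rep[OF H] by auto
  next
    fix m n assume mn: "graph_iso (G m) H" "graph_iso (G n) H"
    have fixp: "G k = rep H" if k: "graph_iso (G k) H" for k
    proof -
      obtain K where K: "fin_graph K" "G k = rep K" using from_range by blast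
      have "graph_iso K (rep K)" using rep[OF K(1)] graph_iso_sym by blast
      then have "graph_iso K H" using k unfolding K(2) by (rule graph_iso_trans)
      then show ?thesis using rep_eq[OF K(1) H] K(2) by simp
    qed
    have "G m = G n" using fixp[OF mn(1)] fixp[OF mn(2)] by simp
    then show "m = n" using inj by (simp add: inj_eq)
  qed
  ultimately show ?thesis unfolding enumerates_finite_graphs_def by blast
qed

end

theory Submission
  imports Defs
begin

text \<open>For a graphon \<open>W\<close> put \<open>F l W = l * t(H1, W) + (2 - l) * t(H2, 1 - W)\<close>.  Then \<open>c_lam G l H1 H2\<close>
  is the infimum of \<open>F l W\<close> over all graphons.  It is at most \<open>F l W\<close> because, up to \<open>O(1/m)\<close>,
  some graph on \<open>m\<close> vertices does at least as well as \<open>W\<close>: restricted to injective maps, the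
  objective has expectation at most \<open>F l W\<close> at a random sample of \<open>m\<close> points, and it is affine in
  each edge weight separately, so the weights of a good sample can be rounded to 0 or 1 one
  by one without increasing it.  It is at least the infimum because graphs are step graphons
  up to \<open>O(1/m)\<close>.

  The constant graphon \<open>p\<close> has \<open>F l p = 2 * p ^ e(H1)\<close> for every \<open>l\<close>, which is the upper bound.
  In the case of equality some \<open>l\<close> attains the supremum, so \<open>F l\<close> is minimal at the constant \<open>p\<close>.
  Differentiating along constant graphons fixes the ratio of \<open>l\<close> and \<open>2 - l\<close>, and
  minimality at this \<open>l\<close> is commonness.\<close>

section \<open>Homomorphism densities of graphons\<close>

abbreviation unit_power :: "'i set \<Rightarrow> ('i \<Rightarrow> real) measure" where
  "unit_power I \<equiv> Pi\<^sub>M I (\<lambda>_. unit_space)"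

definition edge_weight :: "'a ugraph \<Rightarrow> (real \<Rightarrow> real \<Rightarrow> real) \<Rightarrow> ('a \<Rightarrow> real) \<Rightarrow> real" where
  "edge_weight H W x = (\<Prod>e\<in>edges H. case endpoints e of (u, v) \<Rightarrow> W (x u) (x v))"

lemma graphon_density_eq: "graphon_density H W = (\<integral>x. edge_weight H W x \<partial>unit_power (verts H))"
  unfolding graphon_density_def edge_weight_def ..

lemma space_unit_space [simp]: "space unit_space = {0..1}"
  by (simp add: unit_space_def space_restrict_space)

lemma prob_space_unit_space: "prob_space unit_space"
  unfolding unit_space_def by (rule prob_space_restrict_space) auto

lemma prob_space_unit_power: "prob_space (unit_power I)"
  by (intro prob_space_PiM prob_space_unit_space)

lemma fin_graph_finite_edges: "fin_graph H \<Longrightarrow> finite (edges H)"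
  unfolding fin_graph_def using finite_imp_finite_nsets finite_subset by blast

lemma endpoints_eqE:
  assumes "e \<in> nsets V 2"
  obtains u v where "endpoints e = (u, v)" "e = {u, v}" "u \<in> V" "v \<in> V" "u \<noteq> v"
proof -
  obtain a b where ab: "e = {a, b}" "a \<in> V" "b \<in> V" "a \<noteq> b"
    using assms by (auto elim: nsets2_E)
  have "e = {fst (endpoints e), snd (endpoints e)}"
    unfolding endpoints_def by (rule someI[of _ "(a, b)"]) (simp add: ab)
  then show ?thesis
    using that[of "fst (endpoints e)" "snd (endpoints e)"] ab by (auto simp: doubleton_eq_iff)
qed

lemma fin_graph_edgeE:
  assumes "fin_graph H" "e \<in> edges H"
  obtains u v where "endpoints e = (u, v)" "e = {u, v}" "u \<in> verts H" "v \<in> verts H" "u \<noteq> v"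
  using assms endpoints_eqE unfolding fin_graph_def by (metis subsetD)

lemma graphon_compl: "graphon W \<Longrightarrow> graphon (\<lambda>x y. 1 - W x y)"
  unfolding graphon_def by (auto simp: case_prod_beta)

lemma edge_weight_measurable:
  assumes "fin_graph H" "graphon W"
  shows "edge_weight H W \<in> borel_measurable (unit_power (verts H))"
  unfolding edge_weight_def
proof (intro borel_measurable_prod)
  fix e assume e: "e \<in> edges H"
  obtain u v where uv: "endpoints e = (u, v)" "u \<in> verts H" "v \<in> verts H"
    using fin_graph_edgeE[OF assms(1) e] by metis
  have "(\<lambda>x. (x u, x v)) \<in> unit_power (verts H) \<rightarrow>\<^sub>M unit_space \<Otimes>\<^sub>M unit_space"
    using uv by measurable
  then have "(\<lambda>x. (\<lambda>(x, y). W x y) (x u, x v)) \<in> borel_measurable (unit_power (verts H))"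
    using assms(2) unfolding graphon_def by (elim measurable_compose) auto
  then show "(\<lambda>x. case endpoints e of (u, v) \<Rightarrow> W (x u) (x v)) \<in> borel_measurable (unit_power (verts H))"
    by (simp add: uv)
qed

lemma edge_weight_bounds:
  assumes "fin_graph H" "graphon W" "x \<in> space (unit_power (verts H))"
  shows "edge_weight H W x \<in> {0..1}"
proof -
  have "(case endpoints e of (u, v) \<Rightarrow> W (x u) (x v)) \<in> {0..1}" if e: "e \<in> edges H" for e
  proof -
    obtain u v where uv: "endpoints e = (u, v)" "u \<in> verts H" "v \<in> verts H"
      using fin_graph_edgeE[OF assms(1) e] by metis
    then have "x u \<in> {0..1}" "x v \<in> {0..1}" using assms(3) by (auto simp: space_PiM)
    then show ?thesis using assms(2) uv unfolding graphon_def by auto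
  qed
  then show ?thesis
    unfolding edge_weight_def by (auto intro!: prod_nonneg prod_le_1)
qed

lemma edge_weight_integrable:
  assumes "fin_graph H" "graphon W"
  shows "integrable (unit_power (verts H)) (edge_weight H W)"
proof -
  interpret prob_space "unit_power (verts H)" by (rule prob_space_unit_power)
  have "norm (edge_weight H W x) \<le> 1" if "x \<in> space (unit_power (verts H))" for x
    using edge_weight_bounds[OF assms, of x] that by auto
  then show ?thesis
    by (intro integrable_const_bound[where B = 1] edge_weight_measurable assms AE_I2)
qed

lemma graphon_density_nonneg:
  assumes "fin_graph H" "graphon W" shows "0 \<le> graphon_density H W"
  unfolding graphon_density_eq using edge_weight_bounds[OF assms]
  by (intro Bochner_Integration.integral_nonneg) auto

lemma graphon_const: "c \<in> {0..1} \<Longrightarrow> graphon (\<lambda>_ _. c)"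
  unfolding graphon_def by auto

lemma graphon_density_const:
  "graphon_density H (\<lambda>_ _. c) = c ^ num_edges H"
proof -
  interpret prob_space "unit_power (verts H)" by (rule prob_space_unit_power)
  show ?thesis unfolding graphon_density_def num_edges_def by (simp add: prob_space)
qed

text \<open>Distinct coordinates of a uniform point of the cube are again independent and uniform,
  so reading the sample along an injective \<open>f\<close> preserves the measure. Repeated
  coordinates would destroy independence, which is why sampling only counts injective maps.\<close>

lemma edge_weight_sample:
  assumes "fin_graph H" "graphon W" "inj_on f (verts H)" "f \<in> verts H \<rightarrow> J"
  shows "integrable (unit_power J) (\<lambda>x. edge_weight H W (x \<circ> f))"
    and "(\<integral>x. edge_weight H W (x \<circ> f) \<partial>unit_power J) = graphon_density H W"
proof -
  \<comment> \<open>The product measure lives on functions that are undefined off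
    \<open>verts H\<close>, hence the restriction; \<open>edge_weight\<close> only looks at vertices
    of \<open>H\<close> and does not notice it.\<close>
  let ?t = "\<lambda>x. \<lambda>v\<in>verts H. x (f v) :: real"
  have eq: "edge_weight H W (?t x) = edge_weight H W (x \<circ> f)" for x
    unfolding edge_weight_def
  proof (rule prod.cong[OF refl])
    fix e assume e: "e \<in> edges H"
    obtain u v where "endpoints e = (u, v)" "u \<in> verts H" "v \<in> verts H"
      using fin_graph_edgeE[OF assms(1) e] by metis
    then show "(case endpoints e of (u, v) \<Rightarrow> W (?t x u) (?t x v)) =
          (case endpoints e of (u, v) \<Rightarrow> W ((x \<circ> f) u) ((x \<circ> f) v))"
      by simp
  qed
  have distr: "distr (unit_power J) (unit_power (verts H)) ?t = unit_power (verts H)"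
    using distr_PiM_reindex[of J "\<lambda>_. unit_space" f "verts H"] prob_space_unit_space assms by auto
  have t: "?t \<in> unit_power J \<rightarrow>\<^sub>M unit_power (verts H)"
    using assms(4) by (intro measurable_restrict measurable_component_singleton) auto
  note meas = edge_weight_measurable[OF assms(1,2)]
  show "integrable (unit_power J) (\<lambda>x. edge_weight H W (x \<circ> f))"
    using edge_weight_integrable[OF assms(1,2)] integrable_distr_eq[OF t meas]
    by (simp add: distr eq)
  show "(\<integral>x. edge_weight H W (x \<circ> f) \<partial>unit_power J) = graphon_density H W"
    using integral_distr[OF t meas] by (simp add: distr eq graphon_density_eq)
qed

text \<open>The probabilistic method: a function lying strictly above its mean everywhere would have
  a larger integral.\<close>

lemma (in prob_space) exists_le_expectation:
  fixes f :: "'a \<Rightarrow> real"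
  assumes "integrable M f"
  shows "\<exists>x\<in>space M. f x \<le> expectation f"
proof (rule ccontr)
  assume "\<not> ?thesis"
  then have gt: "\<And>x. x \<in> space M \<Longrightarrow> expectation f < f x" by force
  have "(\<integral>x. expectation f \<partial>M) < expectation f"
    using gt by (intro integral_less_AE_space) (auto simp: assms emeasure_space_1)
  then show False by (simp add: prob_space)
qed

section \<open>Rounding edge weights\<close>

text \<open>Stating affinity as interpolation between 0 and 1 gives directly what rounding needs: a
  value at a weight in the unit interval is a convex combination of the values at its two
  roundings.\<close>

definition multi_affine :: "(('i \<Rightarrow> real) \<Rightarrow> real) \<Rightarrow> bool" where
  "multi_affine F \<longleftrightarrow> (\<forall>w i t. F (w(i := t)) = (1 - t) * F (w(i := 0)) + t * F (w(i := 1)))"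

lemma multi_affine_add:
  assumes "multi_affine F" "multi_affine F'"
  shows "multi_affine (\<lambda>w. F w + F' w)"
  unfolding multi_affine_def
proof (intro allI)
  fix w i t
  have eqs: "F (w(i := t)) = (1 - t) * F (w(i := 0)) + t * F (w(i := 1))"
    "F' (w(i := t)) = (1 - t) * F' (w(i := 0)) + t * F' (w(i := 1))"
    using assms unfolding multi_affine_def by blast+
  show "F (w(i := t)) + F' (w(i := t)) = (1 - t) * (F (w(i := 0)) + F' (w(i := 0)))
      + t * (F (w(i := 1)) + F' (w(i := 1)))"
    unfolding eqs by (simp add: algebra_simps)
qed

lemma multi_affine_cmult:
  assumes "multi_affine F"
  shows "multi_affine (\<lambda>w. c * F w)"
  unfolding multi_affine_def
proof (intro allI)
  fix w i t
  have eq: "F (w(i := t)) = (1 - t) * F (w(i := 0)) + t * F (w(i := 1))"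
    using assms unfolding multi_affine_def by blast
  show "c * F (w(i := t)) = (1 - t) * (c * F (w(i := 0))) + t * (c * F (w(i := 1)))"
    unfolding eq by (simp add: algebra_simps)
qed

lemma multi_affine_zero: "multi_affine (\<lambda>_. 0)"
  by (simp add: multi_affine_def)

lemma multi_affine_sum:
  "(\<And>k. k \<in> K \<Longrightarrow> multi_affine (F k)) \<Longrightarrow> multi_affine (\<lambda>w. \<Sum>k\<in>K. F k w)"
  by (induction K rule: infinite_finite_induct)
    (simp_all add: multi_affine_zero multi_affine_add)

text \<open>By injectivity of \<open>g\<close> a variable enters at most one factor, and there
  affinely. The two uses are \<open>h t = t\<close> for edges and \<open>h t = 1 - t\<close> for
  edges of the complement.\<close>

lemma multi_affine_prod:
  assumes "finite E" "inj_on g E" and h: "\<And>t :: real. h t = (1 - t) * h 0 + t * h 1"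
  shows "multi_affine (\<lambda>w. \<Prod>e\<in>E. h (w (g e)))"
  unfolding multi_affine_def
proof (intro allI)
  fix w i and t :: real
  show "(\<Prod>e\<in>E. h ((w(i := t)) (g e))) = (1 - t) * (\<Prod>e\<in>E. h ((w(i := 0)) (g e)))
          + t * (\<Prod>e\<in>E. h ((w(i := 1)) (g e)))"
  proof (cases "i \<in> g ` E")
    case True
    then obtain e0 where e0: "e0 \<in> E" "i = g e0" by blast
    have eq: "(\<Prod>e\<in>E. h ((w(i := s)) (g e))) = h s * (\<Prod>e\<in>E - {e0}. h (w (g e)))" for s
    proof -
      have "(\<Prod>e\<in>E - {e0}. h ((w(i := s)) (g e))) = (\<Prod>e\<in>E - {e0}. h (w (g e)))"
        using e0 assms(2) by (intro prod.cong) (auto dest: inj_onD)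
      then show ?thesis
        using prod.remove[OF assms(1) e0(1), of "\<lambda>e. h ((w(i := s)) (g e))"] e0 by simp
    qed
    show ?thesis unfolding eq h[of t] by (simp add: distrib_right mult.assoc)
  next
    case False
    then have "(\<Prod>e\<in>E. h ((w(i := s)) (g e))) = (\<Prod>e\<in>E. h (w (g e)))" for s
      by (intro prod.cong) auto
    then show ?thesis by (simp add: algebra_simps)
  qed
qed

text \<open>An affine function on an interval is minimal at an endpoint; the coordinates in
  \<open>P\<close> are moved to endpoints one after another.\<close>

lemma multi_affine_rounding:
  assumes "multi_affine F" "finite P" "\<And>i. i \<in> P \<Longrightarrow> w i \<in> {0..1}"
  shows "\<exists>w'. (\<forall>i\<in>P. w' i \<in> {0, 1}) \<and> F w' \<le> F w"
proof -
  \<comment> \<open>Agreement with \<open>w\<close> off \<open>P\<close> is added for the induction: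
    it keeps the value already chosen for \<open>i\<close> when the remaining coordinates are
    rounded.\<close>
  have "\<exists>w'. (\<forall>i\<in>P. w' i \<in> {0, 1}) \<and> (\<forall>i. i \<notin> P \<longrightarrow> w' i = w i) \<and> F w' \<le> F w"
    using assms(2,3)
  proof (induction P arbitrary: w rule: finite_induct)
    case empty
    then show ?case by blast
  next
    case (insert i P)
    have "F w = (1 - w i) * F (w(i := 0)) + w i * F (w(i := 1))"
      using assms(1) fun_upd_triv[of w i] unfolding multi_affine_def by metis
    moreover have "0 \<le> w i" "w i \<le> 1" using insert.prems[of i] by auto
    \<comment> \<open>If both endpoint values exceeded \<open>F w\<close>, so would their convex
      combination, which is \<open>F w\<close> itself. The signs are flipped because
      \<open>convex_bound_lt\<close> bounds from above.\<close>
    ultimately have "\<not> (F w < F (w(i := 0)) \<and> F w < F (w(i := 1)))"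
      using convex_bound_lt[of "- F (w(i := 0))" "- F w" "- F (w(i := 1))" "1 - w i" "w i"] by force
    then obtain b :: real where b: "b \<in> {0, 1}" "F (w(i := b)) \<le> F w"
      by (meson insertI1 insertI2 not_less)
    have "\<exists>w'. (\<forall>j\<in>P. w' j \<in> {0, 1}) \<and> (\<forall>j. j \<notin> P \<longrightarrow> w' j = (w(i := b)) j) \<and> F w' \<le> F (w(i := b))"
      using insert.prems insert.hyps(2) by (intro insert.IH) auto
    then obtain w' where w': "\<forall>j\<in>P. w' j \<in> {0, 1}" "\<forall>j. j \<notin> P \<longrightarrow> w' j = (w(i := b)) j"
      "F w' \<le> F (w(i := b))" by blast
    show ?case
    proof (intro exI conjI)
      show "\<forall>j\<in>insert i P. w' j \<in> {0, 1}" using w' b insert.hyps(2) by auto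
      show "\<forall>j. j \<notin> insert i P \<longrightarrow> w' j = w j" using w' by auto
      show "F w' \<le> F w" using w'(3) b(2) by linarith
    qed
  qed
  then show ?thesis by blast
qed

lemma edge_image_in_nsets:
  assumes "fin_graph H" "inj_on f (verts H)" "f \<in> verts H \<rightarrow> V" "e \<in> edges H"
  shows "f ` e \<in> nsets V 2"
proof -
  obtain u v where "e = {u, v}" "u \<in> verts H" "v \<in> verts H" "u \<noteq> v"
    using fin_graph_edgeE[OF assms(1,4)] by metis
  then show ?thesis using assms(2,3) by (auto dest: inj_onD)
qed

text \<open>Supplies the injectivity in \<open>multi_affine_prod\<close>: no pair weight occurs
  twice in the product belonging to one injective map.\<close>

lemma inj_on_edge_image:
  assumes "fin_graph H" "inj_on f (verts H)"
  shows "inj_on ((`) f) (edges H)"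
  using inj_on_nsets[OF assms(2)] assms(1) inj_on_subset unfolding fin_graph_def by blast

section \<open>Homomorphism densities of finite graphs\<close>

text \<open>A product of edge indicators tests being a homomorphism. In this form the density of a
  graph can be compared with \<open>edge_weight\<close> map by map.\<close>

lemma hom_density_eq:
  assumes "fin_graph H" "fin_graph G"
  shows "hom_density H G =
    (\<Sum>f\<in>verts H \<rightarrow>\<^sub>E verts G. \<Prod>e\<in>edges H. of_bool (f ` e \<in> edges G))
      / real (card (verts G)) ^ card (verts H)"
proof -
  let ?S = "verts H \<rightarrow>\<^sub>E verts G"
  have fin: "finite ?S" "?S \<noteq> {}"
    using assms unfolding fin_graph_def by (auto intro: finite_PiE simp: PiE_eq_empty_iff)
  have "(\<Prod>e\<in>edges H. of_bool (f ` e \<in> edges G)) = (of_bool (is_hom H G f) :: real)"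
    if "f \<in> ?S" for f
    using that fin_graph_finite_edges[OF assms(1)] unfolding is_hom_def
    by (cases "\<forall>e\<in>edges H. f ` e \<in> edges G") (auto simp: prod_zero_iff PiE_def)
  then have "(\<Sum>f\<in>?S. \<Prod>e\<in>edges H. of_bool (f ` e \<in> edges G)) = real (card (?S \<inter> {f. is_hom H G f}))"
    using fin by (simp add: sum.If_cases of_bool_def)
  moreover have "card ?S = card (verts G) ^ card (verts H)"
    using assms unfolding fin_graph_def by (simp add: card_PiE)
  ultimately show ?thesis
    unfolding hom_density_def by (simp add: measure_pmf_of_set[OF fin(2,1)])
qed

text \<open>A union bound over ordered pairs of distinct vertices: a collision at a given pair has
  probability \<open>1 / card U\<close>. This is the source of every \<open>O(1/m)\<close>
  error.\<close>

lemma card_non_injective_le: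
  assumes "finite V" "finite U" "U \<noteq> {}"
  shows "real (card {f \<in> V \<rightarrow>\<^sub>E U. \<not> inj_on f V}) / real (card U) ^ card V \<le> (real (card V))\<^sup>2 / real (card U)"
proof -
  have N: "card U > 0" using assms by (simp add: card_gt_0_iff)
  let ?P = "{(u, v) \<in> V \<times> V. u \<noteq> v}"
  define B where "B = (\<lambda>(u, v). {f \<in> V \<rightarrow>\<^sub>E U. f u = f v})"
  have finPE: "finite (V \<rightarrow>\<^sub>E U)" "\<And>v. finite ((V - {v}) \<rightarrow>\<^sub>E U)"
    using assms by (auto intro: finite_PiE)
  have card_B: "real (card (B p)) \<le> real (card U) ^ card V / real (card U)" if p_in: "p \<in> ?P" for p
  proof -
    obtain u v where p: "p = (u, v)" "u \<in> V" "v \<in> V" "u \<noteq> v"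
      using p_in by blast
    \<comment> \<open>For maps in \<open>B p\<close> the value at \<open>v\<close> can be recovered
      from the value at \<open>u\<close>, so forgetting it loses nothing.\<close>
    have "inj_on (\<lambda>f. restrict f (V - {v})) (B p)"
    proof (rule inj_onI)
      fix f g assume fg: "f \<in> B p" "g \<in> B p" "restrict f (V - {v}) = restrict g (V - {v})"
      have eq: "f w = g w" if "w \<in> V - {v}" for w
        using fun_cong[OF fg(3), of w] that by simp
      have "f v = g v" using eq[of u] fg p by (auto simp: B_def)
      then show "f = g"
        using fg(1,2) eq p(1) by (intro PiE_ext[of f V "\<lambda>_. U" g]) (auto simp: B_def)
    qed
    moreover have "(\<lambda>f. restrict f (V - {v})) ` B p \<subseteq> (V - {v}) \<rightarrow>\<^sub>E U"
      unfolding B_def p by (intro image_subsetI restrict_PiE_iff[THEN iffD2] ballI) auto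
    ultimately have "card (B p) \<le> card ((V - {v}) \<rightarrow>\<^sub>E U)"
      using card_inj_on_le finPE(2) by blast
    also have "\<dots> = card U ^ (card V - 1)" using assms p by (simp add: card_PiE)
    finally have "real (card (B p)) \<le> real (card U ^ (card V - 1))" by (rule of_nat_mono)
    \<comment> \<open>\<open>V\<close> contains \<open>u\<close>, so the subtraction in the exponent
      is not truncated.\<close>
    also have "\<dots> = real (card U) ^ card V / real (card U)"
      using N p(2) assms(1) by (cases "card V") auto
    finally show ?thesis .
  qed
  have cover: "{f \<in> V \<rightarrow>\<^sub>E U. \<not> inj_on f V} \<subseteq> (\<Union>p\<in>?P. B p)"
  proof
    fix f assume "f \<in> {f \<in> V \<rightarrow>\<^sub>E U. \<not> inj_on f V}"
    then obtain u v where "f \<in> V \<rightarrow>\<^sub>E U" "u \<in> V" "v \<in> V" "u \<noteq> v" "f u = f v"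
      unfolding inj_on_def by blast
    then show "f \<in> (\<Union>p\<in>?P. B p)" by (intro UN_I[of "(u, v)"]) (simp_all add: B_def)
  qed
  have finP: "finite ?P" using assms(1) by (auto intro: finite_subset[of _ "V \<times> V"])
  have "finite (B p)" for p using finPE(1) by (cases p) (auto simp: B_def)
  then have "card {f \<in> V \<rightarrow>\<^sub>E U. \<not> inj_on f V} \<le> card (\<Union>p\<in>?P. B p)"
    using finP by (intro card_mono cover finite_UN_I)
  also have "\<dots> \<le> (\<Sum>p\<in>?P. card (B p))" by (rule card_UN_le[OF finP])
  finally have "real (card {f \<in> V \<rightarrow>\<^sub>E U. \<not> inj_on f V}) \<le> real (\<Sum>p\<in>?P. card (B p))"
    by (rule of_nat_mono)
  also have "\<dots> = (\<Sum>p\<in>?P. real (card (B p)))" by simp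
  also have "\<dots> \<le> real (card ?P) * (real (card U) ^ card V / real (card U))"
    using card_B by (rule sum_bounded_above)
  also have "\<dots> \<le> (real (card V))\<^sup>2 * (real (card U) ^ card V / real (card U))"
  proof (rule mult_right_mono)
    have "card ?P \<le> card (V \<times> V)" using assms(1) by (intro card_mono) auto
    then have "card ?P \<le> (card V)\<^sup>2" by (simp add: card_cartesian_product power2_eq_square)
    from of_nat_mono[OF this, where 'a = real] show "real (card ?P) \<le> (real (card V))\<^sup>2"
      by (simp only: of_nat_power)
  qed simp
  finally show ?thesis using N by (simp add: field_simps)
qed

section \<open>Sampling a graph from a graphon\<close>

text \<open>These maps send edges to genuine pairs and see independent sample points; all other maps
  go into the error term.\<close>

definition inj_maps :: "'a set \<Rightarrow> 'b set \<Rightarrow> ('a \<Rightarrow> 'b) set" where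
  "inj_maps V U = {f \<in> V \<rightarrow>\<^sub>E U. inj_on f V}"

lemma sum_PiE_le_sum_inj_maps:
  fixes h :: "('a \<Rightarrow> 'b) \<Rightarrow> real"
  assumes "finite V" "finite U" "U \<noteq> {}" "\<And>f. f \<in> V \<rightarrow>\<^sub>E U \<Longrightarrow> h f \<le> 1"
  shows "(\<Sum>f\<in>V \<rightarrow>\<^sub>E U. h f) / real (card U) ^ card V
    \<le> (\<Sum>f\<in>inj_maps V U. h f) / real (card U) ^ card V + (real (card V))\<^sup>2 / real (card U)"
proof -
  let ?N = "{f \<in> V \<rightarrow>\<^sub>E U. \<not> inj_on f V}"
  have fin: "finite (V \<rightarrow>\<^sub>E U)" using assms by (auto intro: finite_PiE)
  have "(\<Sum>f\<in>V \<rightarrow>\<^sub>E U. h f) = (\<Sum>f\<in>inj_maps V U. h f) + (\<Sum>f\<in>?N. h f)"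
    using fin by (subst sum.union_disjoint[symmetric]) (auto simp: inj_maps_def intro: sum.cong)
  also have "(\<Sum>f\<in>?N. h f) \<le> (\<Sum>f\<in>?N. 1)" using assms(4) by (intro sum_mono) auto
  also have "\<dots> = real (card ?N)" by simp
  finally have "(\<Sum>f\<in>V \<rightarrow>\<^sub>E U. h f) / real (card U) ^ card V
      \<le> ((\<Sum>f\<in>inj_maps V U. h f) + real (card ?N)) / real (card U) ^ card V"
    by (intro divide_right_mono) auto
  then show ?thesis
    using card_non_injective_le[OF assms(1-3)] by (simp add: add_divide_distrib)
qed

text \<open>Weights are indexed by unordered pairs so that each potential edge is a single
  coordinate for the rounding.\<close>

definition pair_weight :: "(real \<Rightarrow> real \<Rightarrow> real) \<Rightarrow> ('b \<Rightarrow> real) \<Rightarrow> 'b set \<Rightarrow> real" where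
  "pair_weight W x e = (case endpoints e of (u, v) \<Rightarrow> W (x u) (x v))"

lemma pair_weight_doubleton:
  assumes "u \<in> V" "v \<in> V" "u \<noteq> v" "x \<in> V \<rightarrow> {0..1}"
    and "\<And>s t. s \<in> {0..1} \<Longrightarrow> t \<in> {0..1} \<Longrightarrow> W s t = W t s"
  shows "pair_weight W x {u, v} = W (x u) (x v)"
proof -
  have "{u, v} \<in> nsets V 2" using assms by simp
  then obtain a b where ab: "endpoints {u, v} = (a, b)" "{u, v} = {a, b}"
    using endpoints_eqE by metis
  have "x u \<in> {0..1}" "x v \<in> {0..1}" using assms(1,2,4) by auto
  then show ?thesis
    unfolding pair_weight_def ab(1) using ab(2) assms(5) by (auto simp: doubleton_eq_iff)
qed

lemma edge_weight_comp:
  assumes "fin_graph H" "graphon W" "f \<in> inj_maps (verts H) J" "x \<in> space (unit_power J)"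
  shows "edge_weight H W (x \<circ> f) = (\<Prod>e\<in>edges H. pair_weight W x (f ` e))"
  unfolding edge_weight_def
proof (rule prod.cong[OF refl])
  fix e assume e: "e \<in> edges H"
  obtain u v where uv: "endpoints e = (u, v)" "e = {u, v}" "u \<in> verts H" "v \<in> verts H" "u \<noteq> v"
    using fin_graph_edgeE[OF assms(1) e] by metis
  have f: "f \<in> verts H \<rightarrow> J" "inj_on f (verts H)"
    using assms(3) by (auto simp: inj_maps_def)
  have "pair_weight W x {f u, f v} = W (x (f u)) (x (f v))"
  proof (rule pair_weight_doubleton[of _ J])
    show "f u \<noteq> f v" using f(2) uv by (auto dest: inj_onD)
    show "x \<in> J \<rightarrow> {0..1}" using assms(4) by (auto simp: space_PiM)
    show "W s t = W t s" if "s \<in> {0..1}" "t \<in> {0..1}" for s t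
      using assms(2) that unfolding graphon_def by blast
  qed (use f uv in auto)
  then show "(case endpoints e of (u, v) \<Rightarrow> W ((x \<circ> f) u) ((x \<circ> f) v)) = pair_weight W x (f ` e)"
    using uv by simp
qed

lemma pair_weight_bounds:
  assumes "graphon W" "x \<in> space (unit_power J)" "e \<in> nsets J 2"
  shows "pair_weight W x e \<in> {0..1}"
proof -
  obtain u v where uv: "endpoints e = (u, v)" "u \<in> J" "v \<in> J"
    using endpoints_eqE[OF assms(3)] by metis
  have "x u \<in> {0..1}" "x v \<in> {0..1}" using uv assms(2) by (auto simp: space_PiM)
  then show ?thesis
    using uv assms(1) unfolding graphon_def by (simp add: pair_weight_def)
qed

text \<open>Lets one vector of weights describe both the sampled graph and its complement.\<close>

lemma pair_weight_compl: "pair_weight (\<lambda>x y. 1 - W x y) x e = 1 - pair_weight W x e"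
  by (simp add: pair_weight_def case_prod_beta)

text \<open>Every injective map contributes exactly the density of \<open>W\<close>. As that density
  is nonnegative, the number of injective maps may be replaced by the number of all maps.\<close>

lemma integral_inj_maps_le:
  assumes H: "fin_graph H" and W: "graphon W" and U: "finite U"
  shows "integrable (unit_power U) (\<lambda>x. \<Sum>f\<in>inj_maps (verts H) U. edge_weight H W (x \<circ> f))"
    and "(\<integral>x. (\<Sum>f\<in>inj_maps (verts H) U. edge_weight H W (x \<circ> f)) \<partial>unit_power U)
      \<le> graphon_density H W * real (card U) ^ card (verts H)"
proof -
  have f: "inj_on f (verts H)" "f \<in> verts H \<rightarrow> U" if "f \<in> inj_maps (verts H) U" for f
    using that unfolding inj_maps_def by auto
  note samp = edge_weight_sample[OF H W f]
  show "integrable (unit_power U) (\<lambda>x. \<Sum>f\<in>inj_maps (verts H) U. edge_weight H W (x \<circ> f))"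
    by (intro Bochner_Integration.integrable_sum samp(1))
  have "(\<integral>x. (\<Sum>f\<in>inj_maps (verts H) U. edge_weight H W (x \<circ> f)) \<partial>unit_power U)
      = (\<Sum>f\<in>inj_maps (verts H) U. graphon_density H W)"
    using samp by (subst Bochner_Integration.integral_sum) simp_all
  also have "\<dots> = graphon_density H W * real (card (inj_maps (verts H) U))" by simp
  also have "\<dots> \<le> graphon_density H W * real (card (verts H \<rightarrow>\<^sub>E U))"
    using H U graphon_density_nonneg[OF H W] unfolding fin_graph_def inj_maps_def
    by (intro mult_left_mono of_nat_mono card_mono finite_PiE) auto
  also have "card (verts H \<rightarrow>\<^sub>E U) = card U ^ card (verts H)"
    using H unfolding fin_graph_def by (simp add: card_PiE)
  finally show "(\<integral>x. (\<Sum>f\<in>inj_maps (verts H) U. edge_weight H W (x \<circ> f)) \<partial>unit_power U)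
      \<le> graphon_density H W * real (card U) ^ card (verts H)"
    by (simp only: of_nat_power)
qed

lemma hom_density_le_inj_maps:
  assumes H: "fin_graph H" and G: "fin_graph G"
  shows "hom_density H G
    \<le> (\<Sum>f\<in>inj_maps (verts H) (verts G). \<Prod>e\<in>edges H. of_bool (f ` e \<in> edges G))
        / real (card (verts G)) ^ card (verts H) + (real (card (verts H)))\<^sup>2 / real (card (verts G))"
  unfolding hom_density_eq[OF H G] using H G unfolding fin_graph_def
  by (intro sum_PiE_le_sum_inj_maps prod_le_1) auto

lemma fin_graph_complement: "fin_graph G \<Longrightarrow> fin_graph (complement G)"
  unfolding fin_graph_def complement_def by auto

text \<open>Applied to weights that rounding has made 0 or 1, so that \<open>w\<close> is the
  indicator function of the edge set.\<close>

definition threshold_graph :: "'b set \<Rightarrow> ('b set \<Rightarrow> real) \<Rightarrow> 'b ugraph" where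
  "threshold_graph U w = Graph U {e \<in> nsets U 2. w e = 1}"

lemma verts_threshold_graph [simp]: "verts (threshold_graph U w) = U"
  by (simp add: threshold_graph_def)

lemma fin_graph_threshold_graph: "finite U \<Longrightarrow> U \<noteq> {} \<Longrightarrow> fin_graph (threshold_graph U w)"
  by (auto simp: threshold_graph_def fin_graph_def)

lemma hom_density_threshold_graph_le:
  assumes H: "fin_graph H" and U: "finite U" "U \<noteq> {}"
    and w: "\<And>e. e \<in> nsets U 2 \<Longrightarrow> w e \<in> {0, 1}"
  shows "hom_density H (threshold_graph U w)
      \<le> (\<Sum>f\<in>inj_maps (verts H) U. \<Prod>e\<in>edges H. w (f ` e)) / real (card U) ^ card (verts H)
        + (real (card (verts H)))\<^sup>2 / real (card U)"
    and "hom_density H (complement (threshold_graph U w))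
      \<le> (\<Sum>f\<in>inj_maps (verts H) U. \<Prod>e\<in>edges H. 1 - w (f ` e)) / real (card U) ^ card (verts H)
        + (real (card (verts H)))\<^sup>2 / real (card U)"
proof -
  let ?K = "threshold_graph U w"
  have verts_complement: "verts (complement ?K) = U" by (simp add: complement_def)
  have K: "fin_graph ?K" "fin_graph (complement ?K)"
    using fin_graph_threshold_graph[OF U] by (simp_all add: fin_graph_complement)
  have in_K: "of_bool (f ` e \<in> edges ?K) = w (f ` e)"
    "of_bool (f ` e \<in> edges (complement ?K)) = 1 - w (f ` e)"
    if "f \<in> inj_maps (verts H) U" "e \<in> edges H" for f e
  proof -
    have "f ` e \<in> nsets U 2"
      using edge_image_in_nsets[OF H _ _ that(2), of f U] that(1) by (auto simp: inj_maps_def)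
    then show "of_bool (f ` e \<in> edges ?K) = w (f ` e)"
      "of_bool (f ` e \<in> edges (complement ?K)) = 1 - w (f ` e)"
      using w[of "f ` e"] by (auto simp: threshold_graph_def complement_def)
  qed
  show "hom_density H ?K
      \<le> (\<Sum>f\<in>inj_maps (verts H) U. \<Prod>e\<in>edges H. w (f ` e)) / real (card U) ^ card (verts H)
        + (real (card (verts H)))\<^sup>2 / real (card U)"
    using hom_density_le_inj_maps[OF H K(1)] in_K(1) by simp
  show "hom_density H (complement ?K)
      \<le> (\<Sum>f\<in>inj_maps (verts H) U. \<Prod>e\<in>edges H. 1 - w (f ` e)) / real (card U) ^ card (verts H)
        + (real (card (verts H)))\<^sup>2 / real (card U)"
    using hom_density_le_inj_maps[OF H K(2)] in_K(2) by (simp add: verts_complement)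
qed

lemma exists_graph_below_graphon:
  fixes U :: "'c set"
  assumes H1: "fin_graph H1" and H2: "fin_graph H2" and W: "graphon W"
    and ab: "0 \<le> a" "0 \<le> b" and U: "finite U" "U \<noteq> {}"
  obtains K where "fin_graph K" "verts K = U"
    "a * hom_density H1 K + b * hom_density H2 (complement K)
      \<le> a * graphon_density H1 W + b * graphon_density H2 (\<lambda>x y. 1 - W x y)
        + (a * (real (card (verts H1)))\<^sup>2 + b * (real (card (verts H2)))\<^sup>2) / real (card U)"
proof -
  let ?W' = "\<lambda>x y. 1 - W x y"
  note W' = graphon_compl[OF W]
  define N1 where "N1 = real (card U) ^ card (verts H1)"
  define N2 where "N2 = real (card U) ^ card (verts H2)"
  have N: "N1 > 0" "N2 > 0" using U by (auto simp: N1_def N2_def card_gt_0_iff)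
  \<comment> \<open>\<open>F\<close> is the objective restricted to injective maps, as a function of
    the pair weights. It is defined for fractional weights and becomes a bound on graph densities at
    0-1 weights.\<close>
  define F where "F w = a / N1 * (\<Sum>f\<in>inj_maps (verts H1) U. \<Prod>e\<in>edges H1. w (f ` e))
    + b / N2 * (\<Sum>f\<in>inj_maps (verts H2) U. \<Prod>e\<in>edges H2. 1 - w (f ` e))" for w :: "'c set \<Rightarrow> real"
  let ?S1 = "\<lambda>x. \<Sum>f\<in>inj_maps (verts H1) U. edge_weight H1 W (x \<circ> f)"
  let ?S2 = "\<lambda>x. \<Sum>f\<in>inj_maps (verts H2) U. edge_weight H2 ?W' (x \<circ> f)"
  interpret prob_space "unit_power U" by (rule prob_space_unit_power)
  note int1 = integral_inj_maps_le[OF H1 W U(1)] and int2 = integral_inj_maps_le[OF H2 W' U(1)]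
  \<comment> \<open>A sample that does at least as well as the average; one sample must serve both
    densities, hence the combined integrand.\<close>
  obtain x where x: "x \<in> space (unit_power U)"
    "a / N1 * ?S1 x + b / N2 * ?S2 x \<le> (\<integral>x. a / N1 * ?S1 x + b / N2 * ?S2 x \<partial>unit_power U)"
    using exists_le_expectation[of "\<lambda>x. a / N1 * ?S1 x + b / N2 * ?S2 x"] int1(1) int2(1) by auto
  have "F (pair_weight W x) = a / N1 * ?S1 x + b / N2 * ?S2 x"
    using edge_weight_comp[OF H1 W _ x(1)] edge_weight_comp[OF H2 W' _ x(1)]
    by (simp add: F_def pair_weight_compl)
  also note x(2)
  also have "(\<integral>x. a / N1 * ?S1 x + b / N2 * ?S2 x \<partial>unit_power U)
      = a / N1 * (\<integral>x. ?S1 x \<partial>unit_power U) + b / N2 * (\<integral>x. ?S2 x \<partial>unit_power U)"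
    using int1(1) int2(1) by simp
  also have "\<dots> \<le> a / N1 * (graphon_density H1 W * N1) + b / N2 * (graphon_density H2 ?W' * N2)"
    using int1(2) int2(2) ab N unfolding N1_def[symmetric] N2_def[symmetric]
    by (intro add_mono mult_left_mono) auto
  also have "\<dots> = a * graphon_density H1 W + b * graphon_density H2 ?W'" using N by simp
  finally have F_le: "F (pair_weight W x) \<le> a * graphon_density H1 W + b * graphon_density H2 ?W'" .
  have "multi_affine F"
    unfolding F_def
    using multi_affine_prod[OF fin_graph_finite_edges[OF H1] inj_on_edge_image[OF H1], of _ "\<lambda>t. t"]
      multi_affine_prod[OF fin_graph_finite_edges[OF H2] inj_on_edge_image[OF H2], of _ "\<lambda>t. 1 - t"]
    by (intro multi_affine_add multi_affine_cmult multi_affine_sum) (auto simp: inj_maps_def)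
  then obtain w where w: "\<forall>e\<in>nsets U 2. w e \<in> {0, 1}" "F w \<le> F (pair_weight W x)"
    using multi_affine_rounding[of F "nsets U 2" "pair_weight W x"] pair_weight_bounds[OF W x(1)]
      finite_imp_finite_nsets[OF U(1)] by blast
  define K where "K = threshold_graph U w"
  have K: "fin_graph K" "verts K = U" using U by (simp_all add: K_def fin_graph_threshold_graph)
  \<comment> \<open>Returning from injective maps to all maps costs the two error terms.\<close>
  have "a * hom_density H1 K + b * hom_density H2 (complement K)
      \<le> a * ((\<Sum>f\<in>inj_maps (verts H1) U. \<Prod>e\<in>edges H1. w (f ` e)) / N1
          + (real (card (verts H1)))\<^sup>2 / real (card U))
        + b * ((\<Sum>f\<in>inj_maps (verts H2) U. \<Prod>e\<in>edges H2. 1 - w (f ` e)) / N2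
          + (real (card (verts H2)))\<^sup>2 / real (card U))"
    unfolding K_def N1_def N2_def using ab w(1)
    by (intro add_mono mult_left_mono hom_density_threshold_graph_le H1 H2 U) auto
  also have "\<dots> = F w
      + (a * (real (card (verts H1)))\<^sup>2 + b * (real (card (verts H2)))\<^sup>2) / real (card U)"
    by (simp add: F_def distrib_left add_divide_distrib)
  finally show ?thesis using that[OF K] w(2) F_le by linarith
qed

section \<open>Step graphons\<close>

text \<open>The unit interval is cut into \<open>card U\<close> intervals of equal length, each
  labelled by one vertex.\<close>

lemma exists_equipartition:
  fixes U :: "'b set"
  assumes U: "finite U" "U \<noteq> {}"
  obtains g :: "real \<Rightarrow> 'b" where "g \<in> unit_space \<rightarrow>\<^sub>M count_space U"
    "\<And>a. a \<in> U \<Longrightarrow> measure unit_space {x \<in> {0..1}. g x = a} = 1 / real (card U)"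
proof -
  define N where "N = card U"
  have N: "N > 0" using U by (simp add: N_def card_gt_0_iff)
  obtain h where h: "bij_betw h {..<N} U"
    using ex_bij_betw_nat_finite[OF U(1)] by (auto simp: N_def atLeast0LessThan)
  \<comment> \<open>At \<open>x = 1\<close> the floor is \<open>N\<close>; the minimum puts this
    point into the last piece, which is therefore closed on the right.\<close>
  define k where "k x = min (N - 1) (nat \<lfloor>real N * x\<rfloor>)" for x
  have k_less: "k x < N" for x using N by (auto simp: k_def)
  define piece where "piece j = (if j = N - 1 then {real j / N..1} else {real j / N..<(real j + 1) / N})" for j
  have piece: "{x \<in> {0..1}. k x = j} = piece j" if j: "j < N" for j
  proof (intro set_eqI)
    fix x :: real
    show "x \<in> {x \<in> {0..1}. k x = j} \<longleftrightarrow> x \<in> piece j"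
    proof (cases "x \<in> {0..1}")
      case True
      then have x: "0 \<le> real N * x" by simp
      have fl: "nat \<lfloor>real N * x\<rfloor> = i \<longleftrightarrow> real i \<le> real N * x \<and> real N * x < real i + 1" for i
        using x by (auto simp: floor_eq_iff nat_eq_iff)
      have ge: "i \<le> nat \<lfloor>real N * x\<rfloor> \<longleftrightarrow> real i \<le> real N * x" for i
        using x by (simp add: le_nat_iff le_floor_iff)
      show ?thesis
      proof (cases "j = N - 1")
        case True
        then have "k x = j \<longleftrightarrow> j \<le> nat \<lfloor>real N * x\<rfloor>" by (auto simp: k_def)
        then show ?thesis using ge[of j] \<open>x \<in> {0..1}\<close> True N
          by (simp add: piece_def field_simps)
      next
        case False
        then have "k x = j \<longleftrightarrow> nat \<lfloor>real N * x\<rfloor> = j" using j by (auto simp: k_def)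
        then show ?thesis using fl[of j] \<open>x \<in> {0..1}\<close> False N
          by (simp add: piece_def field_simps)
      qed
    next
      case False
      have "piece j \<subseteq> {0..1}"
      proof -
        have "real j + 1 \<le> real N" using j by simp
        then have "(real j + 1) / real N \<le> 1" using N by (simp add: field_simps)
        moreover have "0 \<le> real j / real N" by simp
        ultimately have "0 \<le> x \<and> x \<le> 1" if "x \<in> piece j" for x
          using that unfolding piece_def
          by (cases "j = N - 1";
              simp only: if_True if_False atLeastAtMost_iff atLeastLessThan_iff simp_thms;
              (intro conjI)?; linarith)
        then show ?thesis by auto
      qed
      then show ?thesis using False by auto
    qed
  qed
  have piece_measure: "measure unit_space (piece j) = 1 / real N" if j: "j < N" for j
  proof -
    have sub: "piece j \<subseteq> {0..1}" using piece[OF j] by auto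
    have "measure unit_space (piece j) = measure lborel (piece j)"
      unfolding unit_space_def by (rule measure_restrict_space) (use sub in auto)
    also have "\<dots> = 1 / real N"
      using j N by (auto simp: piece_def divide_simps of_nat_diff Suc_leI)
    finally show ?thesis .
  qed
  show thesis
  proof (rule that[of "\<lambda>x. h (k x)"])
    have "(\<lambda>x. k x) \<in> lborel \<rightarrow>\<^sub>M count_space UNIV" unfolding k_def by measurable
    then have "(\<lambda>x. k x) \<in> unit_space \<rightarrow>\<^sub>M count_space UNIV"
      unfolding unit_space_def by (rule measurable_restrict_space1)
    then have "(\<lambda>x. h (k x)) \<in> unit_space \<rightarrow>\<^sub>M count_space UNIV"
      by (rule measurable_compose) simp
    moreover have "h (k x) \<in> U" for x using h k_less[of x] by (auto simp: bij_betw_def)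
    ultimately show "(\<lambda>x. h (k x)) \<in> unit_space \<rightarrow>\<^sub>M count_space U"
      using measurable_restrict_space2[of "\<lambda>x. h (k x)" unit_space U "count_space UNIV"]
      by (simp add: restrict_count_space)
  next
    fix a assume "a \<in> U"
    then obtain j where j: "j < N" "a = h j" using h by (auto simp: bij_betw_def)
    have "h (k x) = a \<longleftrightarrow> k x = j" for x
      using h k_less[of x] j by (auto simp: bij_betw_def inj_on_def)
    then show "measure unit_space {x \<in> {0..1}. h (k x) = a} = 1 / real (card U)"
      using piece[OF j(1)] piece_measure[OF j(1)] by (simp add: N_def)
  qed
qed

text \<open>The integrand depends only on the labels of the coordinates, so it is constant on each
  box \<open>B f\<close>. All boxes have the same measure, and the integral becomes an average over
  maps.\<close>

lemma integral_equipartition: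
  fixes h :: "('a \<Rightarrow> 'b) \<Rightarrow> real"
  assumes V: "finite V" and U: "finite U"
    and g: "g \<in> unit_space \<rightarrow>\<^sub>M count_space U"
    and m: "\<And>a. a \<in> U \<Longrightarrow> measure unit_space {x \<in> {0..1}. g x = a} = 1 / real (card U)"
  shows "(\<integral>x. h (\<lambda>v\<in>V. g (x v)) \<partial>unit_power V) = (\<Sum>f\<in>V \<rightarrow>\<^sub>E U. h f) / real (card U) ^ card V"
proof -
  interpret unit: prob_space unit_space by (rule prob_space_unit_space)
  interpret S: finite_product_prob_space "\<lambda>_. unit_space" V
    by standard (rule V)
  define P where "P a = {x \<in> {0..1}. g x = a}" for a
  have P_sets: "P a \<in> sets unit_space" if "a \<in> U" for a
  proof -
    have "g -` {a} \<inter> space unit_space \<in> sets unit_space" using that by (intro measurable_sets[OF g]) auto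
    moreover have "g -` {a} \<inter> space unit_space = P a" by (auto simp: P_def)
    ultimately show ?thesis by simp
  qed
  have g_in: "g x \<in> U" if "x \<in> {0..1}" for x using measurable_space[OF g] that by simp
  define B where "B f = (\<Pi>\<^sub>E v\<in>V. P (f v))" for f :: "'a \<Rightarrow> 'b"
  have B_sets: "B f \<in> sets (unit_power V)" if "f \<in> V \<rightarrow>\<^sub>E U" for f
    unfolding B_def using that P_sets by (intro sets_PiM_I_finite V) auto
  have B_measure: "measure (unit_power V) (B f) = 1 / real (card U) ^ card V" if "f \<in> V \<rightarrow>\<^sub>E U" for f
  proof -
    have "measure (unit_power V) (B f) = (\<Prod>v\<in>V. measure unit_space (P (f v)))"
      unfolding B_def using that P_sets by (intro S.finite_measure_PiM_emb) auto
    also have "\<dots> = (\<Prod>v\<in>V. 1 / real (card U))"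
      using that m unfolding P_def by (intro prod.cong) auto
    finally show ?thesis by (simp add: power_one_over)
  qed
  have fin: "finite (V \<rightarrow>\<^sub>E U)" using V U by (auto intro: finite_PiE)
  \<comment> \<open>Each point lies in exactly one box, the one given by its own labels, so the sum
    has one relevant term.\<close>
  have "(\<integral>x. h (\<lambda>v\<in>V. g (x v)) \<partial>unit_power V)
      = (\<integral>x. (\<Sum>f\<in>V \<rightarrow>\<^sub>E U. h f * indicator (B f) x) \<partial>unit_power V)"
  proof (rule Bochner_Integration.integral_cong[OF refl])
    fix x assume "x \<in> space (unit_power V)"
    then have x: "x \<in> V \<rightarrow>\<^sub>E {0..1}" by (simp add: space_PiM)
    let ?f = "\<lambda>v\<in>V. g (x v)"
    have f: "?f \<in> V \<rightarrow>\<^sub>E U" using g_in x by (auto simp: PiE_iff)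
    have "x \<in> B f \<longleftrightarrow> f = ?f" if "f \<in> V \<rightarrow>\<^sub>E U" for f
    proof
      assume xB: "x \<in> B f"
      have "f v = ?f v" if v: "v \<in> V" for v
        using PiE_mem[OF xB[unfolded B_def] v] v by (simp add: P_def)
      then show "f = ?f" using that f by (intro PiE_ext[of f V "\<lambda>_. U"]) auto
    next
      assume "f = ?f"
      then show "x \<in> B f" using x by (auto simp: B_def P_def)
    qed
    then have "(\<Sum>f\<in>V \<rightarrow>\<^sub>E U. h f * indicator (B f) x) = (\<Sum>f\<in>V \<rightarrow>\<^sub>E U. if f = ?f then h f else 0)"
      by (intro sum.cong) (auto simp: indicator_def)
    then show "h ?f = (\<Sum>f\<in>V \<rightarrow>\<^sub>E U. h f * indicator (B f) x)"
      using fin f by (simp add: sum.delta')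
  qed
  also have "\<dots> = (\<Sum>f\<in>V \<rightarrow>\<^sub>E U. h f * measure (unit_power V) (B f))"
    using B_sets by (subst Bochner_Integration.integral_sum) (auto intro!: sum.cong simp: S.emeasure_eq_measure)
  also have "\<dots> = (\<Sum>f\<in>V \<rightarrow>\<^sub>E U. h f) / real (card U) ^ card V"
    using B_measure by (simp add: sum_divide_distrib)
  finally show ?thesis .
qed

lemma edge_weight_step:
  assumes "fin_graph H"
  shows "edge_weight H (\<lambda>x y. \<phi> {g x, g y}) x = (\<Prod>e\<in>edges H. \<phi> ((\<lambda>v\<in>verts H. g (x v)) ` e))"
  unfolding edge_weight_def
proof (rule prod.cong[OF refl])
  fix e assume e: "e \<in> edges H"
  obtain u v where "endpoints e = (u, v)" "e = {u, v}" "u \<in> verts H" "v \<in> verts H"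
    using fin_graph_edgeE[OF assms e] by metis
  then show "(case endpoints e of (u, v) \<Rightarrow> \<phi> {g (x u), g (x v)})
      = \<phi> ((\<lambda>v\<in>verts H. g (x v)) ` e)"
    by simp
qed

text \<open>Only an inequality holds for the complement: the step graphon of \<open>G\<close> vanishes on
  the diagonal blocks, where \<open>1 - W\<close> therefore has loops that \<^term>\<open>complement G\<close> lacks.\<close>

lemma exists_step_graphon:
  fixes G :: "'c ugraph" and H1 :: "'a ugraph" and H2 :: "'b ugraph"
  assumes G: "fin_graph G" and H1: "fin_graph H1" and H2: "fin_graph H2"
  obtains W where "graphon W" "graphon_density H1 W = hom_density H1 G"
    "graphon_density H2 (\<lambda>x y. 1 - W x y)
      \<le> hom_density H2 (complement G) + (real (card (verts H2)))\<^sup>2 / real (card (verts G))"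
proof -
  let ?U = "verts G"
  have U: "finite ?U" "?U \<noteq> {}" using G by (auto simp: fin_graph_def)
  obtain g :: "real \<Rightarrow> 'c" where g: "g \<in> unit_space \<rightarrow>\<^sub>M count_space ?U"
    and m: "\<And>a. a \<in> ?U \<Longrightarrow> measure unit_space {x \<in> {0..1}. g x = a} = 1 / real (card ?U)"
    using exists_equipartition[OF U] by blast
  define W where "W x y = (of_bool ({g x, g y} \<in> edges G) :: real)" for x y
  let ?sq = "unit_space \<Otimes>\<^sub>M unit_space"
  have g1: "(\<lambda>z. g (fst z)) \<in> ?sq \<rightarrow>\<^sub>M count_space ?U" and g2: "(\<lambda>z. g (snd z)) \<in> ?sq \<rightarrow>\<^sub>M count_space ?U"
    by (auto intro: measurable_compose[OF _ g])
  \<comment> \<open>With the first label frozen, measurability only concerns the second; the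
    finitely many values of the first label are then glued together.\<close>
  have "(\<lambda>z. of_bool ({a, g (snd z)} \<in> edges G) :: real) \<in> borel_measurable ?sq" for a
    by (rule measurable_compose[OF g2]) simp
  then have "(\<lambda>z. W (fst z) (snd z)) \<in> borel_measurable ?sq"
    unfolding W_def
    by (rule measurable_compose_countable'[OF _ g1]) (rule countable_finite[OF U(1)])
  then have W: "graphon W"
    unfolding graphon_def by (simp add: case_prod_beta' W_def insert_commute)
  have fin: "finite (verts H1)" "finite (verts H2)" using H1 H2 by (auto simp: fin_graph_def)
  show thesis
  proof (rule that[OF W])
    show "graphon_density H1 W = hom_density H1 G"
      unfolding graphon_density_eq W_def edge_weight_step[OF H1, of "\<lambda>e. of_bool (e \<in> edges G)" g]
        hom_density_eq[OF H1 G]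
      by (rule integral_equipartition[OF fin(1) U(1) g m])
    let ?h = "\<lambda>f. \<Prod>e\<in>edges H2. 1 - of_bool (f ` e \<in> edges G) :: real"
    let ?c = "real (card ?U) ^ card (verts H2)"
    have "graphon_density H2 (\<lambda>x y. 1 - W x y) = (\<Sum>f\<in>verts H2 \<rightarrow>\<^sub>E ?U. ?h f) / ?c"
      unfolding graphon_density_eq W_def
        edge_weight_step[OF H2, of "\<lambda>e. 1 - of_bool (e \<in> edges G)" g]
      by (rule integral_equipartition[OF fin(2) U(1) g m])
    also have "\<dots> \<le> (\<Sum>f\<in>inj_maps (verts H2) ?U. ?h f) / ?c
        + (real (card (verts H2)))\<^sup>2 / real (card ?U)"
      by (intro sum_PiE_le_sum_inj_maps fin U prod_le_1) auto
    \<comment> \<open>Injective maps produce no loops, so here a non-edge of \<open>G\<close> really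
      is an edge of the complement.\<close>
    also have "(\<Sum>f\<in>inj_maps (verts H2) ?U. ?h f)
        = (\<Sum>f\<in>inj_maps (verts H2) ?U. \<Prod>e\<in>edges H2. of_bool (f ` e \<in> edges (complement G)))"
    proof (intro sum.cong prod.cong refl)
      fix f e assume "f \<in> inj_maps (verts H2) ?U" "e \<in> edges H2"
      then have "f ` e \<in> nsets ?U 2"
        using edge_image_in_nsets[OF H2, of f ?U e] by (auto simp: inj_maps_def)
      then show "1 - of_bool (f ` e \<in> edges G) = (of_bool (f ` e \<in> edges (complement G)) :: real)"
        by (simp add: complement_def)
    qed
    also have "\<dots> / ?c \<le> hom_density H2 (complement G)"
      unfolding hom_density_eq[OF H2 fin_graph_complement[OF G]]
      using fin(2) U by (auto simp: complement_def inj_maps_def finite_PiE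
          intro!: divide_right_mono sum_mono2 prod_nonneg)
    finally show "graphon_density H2 (\<lambda>x y. 1 - W x y)
      \<le> hom_density H2 (complement G) + (real (card (verts H2)))\<^sup>2 / real (card ?U)" by simp
  qed
qed

section \<open>Bounds on the constants\<close>

lemma graph_iso_complement:
  assumes G: "fin_graph G" and iso: "graph_iso G G'"
  shows "graph_iso (complement G) (complement G')"
proof -
  obtain b where b: "bij_betw b (verts G) (verts G')" "(`) b ` edges G = edges G'"
    using iso unfolding graph_iso_def by blast
  have nsets: "bij_betw ((`) b) (nsets (verts G) 2) (nsets (verts G') 2)"
    by (rule bij_betw_nsets[OF b(1)])
  have "(`) b ` (nsets (verts G) 2 - edges G) = nsets (verts G') 2 - edges G'"
    using nsets G unfolding bij_betw_def fin_graph_def b(2)[symmetric]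
    by (subst inj_on_image_set_diff[of _ "nsets (verts G) 2"]) auto
  then show ?thesis
    unfolding graph_iso_def using b(1) by (intro exI[of _ b]) (simp add: complement_def)
qed

text \<open>Composition with the isomorphism matches the homomorphisms into both graphs. This is
  needed because the enumeration meets a given graph only up to isomorphism.\<close>

lemma hom_density_iso:
  assumes H: "fin_graph H" and G: "fin_graph G" "fin_graph G'" and iso: "graph_iso G G'"
  shows "hom_density H G = hom_density H G'"
proof -
  obtain b where b: "bij_betw b (verts G) (verts G')" "(`) b ` edges G = edges G'"
    using iso unfolding graph_iso_def by blast
  let ?c = "inv_into (verts G) b"
  have c: "?c (b x) = x" if "x \<in> verts G" for x
    using that b(1) by (simp add: bij_betw_inv_into_left)
  have c': "b (?c y) = y" "?c y \<in> verts G" if "y \<in> verts G'" for y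
    using that b(1) bij_betw_inv_into[OF b(1)] by (auto simp: bij_betw_inv_into_right bij_betw_def)
  have b_in: "b x \<in> verts G'" if "x \<in> verts G" for x
    using that b(1) by (auto simp: bij_betw_def)
  have "(\<Sum>f\<in>verts H \<rightarrow>\<^sub>E verts G. \<Prod>e\<in>edges H. of_bool (f ` e \<in> edges G))
      = (\<Sum>f\<in>verts H \<rightarrow>\<^sub>E verts G'. \<Prod>e\<in>edges H. of_bool (f ` e \<in> edges G') :: real)"
  proof (rule sum.reindex_bij_witness[where j = "\<lambda>f. \<lambda>v\<in>verts H. b (f v)"
        and i = "\<lambda>f. \<lambda>v\<in>verts H. ?c (f v)"])
    fix f assume f: "f \<in> verts H \<rightarrow>\<^sub>E verts G"
    show "(\<lambda>v\<in>verts H. ?c ((\<lambda>v\<in>verts H. b (f v)) v)) = f"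
      using f c by (auto simp: PiE_iff extensional_def)
    show "(\<lambda>v\<in>verts H. b (f v)) \<in> verts H \<rightarrow>\<^sub>E verts G'"
      using f b_in by (auto simp: PiE_iff)
    show "(\<Prod>e\<in>edges H. of_bool ((\<lambda>v\<in>verts H. b (f v)) ` e \<in> edges G'))
        = (\<Prod>e\<in>edges H. of_bool (f ` e \<in> edges G) :: real)"
    proof (rule prod.cong[OF refl])
      fix e assume e: "e \<in> edges H"
      then have sub: "e \<subseteq> verts H" using H by (auto simp: fin_graph_def nsets_def)
      then have "(\<lambda>v\<in>verts H. b (f v)) ` e = b ` f ` e"
        unfolding image_image by (intro image_cong) auto
      moreover have "f ` e \<subseteq> verts G" using f sub by (auto simp: PiE_iff)
      moreover have "edges G \<subseteq> Pow (verts G)" using G(1) by (auto simp: fin_graph_def nsets_def)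
      moreover have "inj_on ((`) b) (Pow (verts G))"
        using b(1) by (auto simp: bij_betw_def intro: inj_on_image_Pow)
      ultimately show "of_bool ((\<lambda>v\<in>verts H. b (f v)) ` e \<in> edges G') = (of_bool (f ` e \<in> edges G) :: real)"
        unfolding b(2)[symmetric] by (simp add: inj_on_image_mem_iff)
    qed
  next
    fix f assume f: "f \<in> verts H \<rightarrow>\<^sub>E verts G'"
    show "(\<lambda>v\<in>verts H. b ((\<lambda>v\<in>verts H. ?c (f v)) v)) = f"
      using f c' by (auto simp: PiE_iff extensional_def)
    show "(\<lambda>v\<in>verts H. ?c (f v)) \<in> verts H \<rightarrow>\<^sub>E verts G"
      using f c' by (auto simp: PiE_iff)
  qed
  then show ?thesis
    unfolding hom_density_eq[OF H G(1)] hom_density_eq[OF H G(2)] bij_betw_same_card[OF b(1)] by simp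
qed

section \<open>Growth of the number of vertices along the enumeration\<close>

lemma graph_iso_lessThan:
  fixes G :: "'a ugraph"
  assumes G: "fin_graph G"
  obtains K :: "nat ugraph" where "fin_graph K" "verts K = {..<card (verts G)}" "graph_iso G K"
proof -
  obtain b where b: "bij_betw b (verts G) {..<card (verts G)}"
    using ex_bij_betw_finite_nat[of "verts G"] G by (auto simp: fin_graph_def atLeast0LessThan)
  let ?K = "Graph {..<card (verts G)} ((`) b ` edges G)"
  have "fin_graph ?K"
    using G bij_betw_nsets[OF b, of 2]
    by (auto simp: fin_graph_def bij_betw_def card_gt_0_iff lessThan_empty_iff)
  moreover have "graph_iso G ?K" unfolding graph_iso_def using b by auto
  ultimately show ?thesis using that by simp
qed

text \<open>There are finitely many isomorphism classes of bounded order, and each is listed once.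
  Hence errors of order \<open>1 / card (verts (G n))\<close> vanish along the sequence.\<close>

lemma enumerates_finite_graphs_card_at_top:
  assumes G: "enumerates_finite_graphs G"
  shows "filterlim (\<lambda>n. card (verts (G n))) at_top sequentially"
proof -
  have fin: "fin_graph (G n)" for n using G by (simp add: enumerates_finite_graphs_def)
  have "finite {n. card (verts (G n)) \<le> N}" for N
  proof -
    define D where "D = case_prod Graph ` (Pow {..<N} \<times> Pow (Pow {..<N} :: nat set set))"
    have "\<exists>K\<in>D. fin_graph K \<and> graph_iso (G n) K" if "card (verts (G n)) \<le> N" for n
    proof -
      obtain K :: "nat ugraph" where K: "fin_graph K" "verts K = {..<card (verts (G n))}" "graph_iso (G n) K"
        using graph_iso_lessThan[OF fin] by blast
      have "verts K \<subseteq> {..<N}" using K(2) that by auto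
      then have "K \<in> D"
        using K(1) unfolding D_def fin_graph_def nsets_def
        by (intro image_eqI[of _ _ "(verts K, edges K)"]) auto
      then show ?thesis using K by blast
    qed
    then obtain k where k: "\<And>n. card (verts (G n)) \<le> N \<Longrightarrow> k n \<in> D \<and> fin_graph (k n) \<and> graph_iso (G n) (k n)"
      by metis
    \<comment> \<open>Two indices with the same standard copy would both represent its class,
      against uniqueness in the enumeration.\<close>
    have "inj_on k {n. card (verts (G n)) \<le> N}"
    proof (rule inj_onI)
      fix m n assume mn: "m \<in> {n. card (verts (G n)) \<le> N}" "n \<in> {n. card (verts (G n)) \<le> N}" "k m = k n"
      then have "fin_graph (k m)" "graph_iso (G m) (k m)" "graph_iso (G n) (k m)"
        using k[of m] k[of n] by auto
      then show "m = n" using G unfolding enumerates_finite_graphs_def by blast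
    qed
    moreover have "k ` {n. card (verts (G n)) \<le> N} \<subseteq> D" using k by auto
    moreover have "finite D" unfolding D_def by simp
    ultimately show ?thesis using finite_imageD finite_subset by blast
  qed
  then have "eventually (\<lambda>n. \<not> card (verts (G n)) \<le> N) sequentially" for N
    unfolding cofinite_eq_sequentially[symmetric] eventually_cofinite by simp
  then show ?thesis
    unfolding filterlim_at_top by (metis (mono_tags, lifting) eventually_mono nle_le)
qed

section \<open>\<open>c_lam\<close> as an infimum over graphons, and attainment of the supremum over
  \<open>l\<close>\<close>

lemma c_lam_le:
  assumes H: "fin_graph H1" "fin_graph H2" and G: "enumerates_finite_graphs G"
    and l: "0 \<le> l" "l \<le> 2" and W: "graphon W"
  shows "c_lam G l H1 H2
    \<le> ereal (l * graphon_density H1 W + (2 - l) * graphon_density H2 (\<lambda>x y. 1 - W x y))"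
proof (rule ccontr)
  let ?a = "l * graphon_density H1 W + (2 - l) * graphon_density H2 (\<lambda>x y. 1 - W x y)"
  let ?X = "\<lambda>K. l * hom_density H1 K + (2 - l) * hom_density H2 (complement K)"
  assume "\<not> c_lam G l H1 H2 \<le> ereal ?a"
  then have "ereal ?a < c_lam G l H1 H2" by (simp only: not_le)
  then obtain z where z: "?a < z" "ereal z < c_lam G l H1 H2"
    using ereal_dense2[of "ereal ?a" "c_lam G l H1 H2"] by auto
  from z(2) have "\<forall>\<^sub>F n in sequentially. ereal z < ereal (?X (G n))"
    unfolding c_lam_def by (rule less_LiminfD)
  then obtain N where N: "\<And>n. n \<ge> N \<Longrightarrow> z < ?X (G n)"
    by (auto simp: eventually_sequentially)
  define C where "C = l * (real (card (verts H1)))\<^sup>2 + (2 - l) * (real (card (verts H2)))\<^sup>2"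
  have "eventually (\<lambda>m. C / real m < z - ?a) sequentially"
    using z(1) by (intro order_tendstoD(2)[OF lim_const_over_n]) simp
  \<comment> \<open>A graph with more vertices than the first \<open>N\<close> listed graphs
    together is isomorphic to none of them, so its index is at least \<open>N\<close>, where the
    objective should exceed \<open>z\<close>.\<close>
  moreover have "eventually (\<lambda>m. (\<Sum>n<N. card (verts (G n))) < m) sequentially"
    by (rule eventually_gt_at_top)
  ultimately have "eventually (\<lambda>m. C / real m < z - ?a \<and> (\<Sum>n<N. card (verts (G n))) < m) sequentially"
    by (rule eventually_conj)
  from eventually_happens'[OF sequentially_bot this]
  obtain m where m: "C / real m < z - ?a" "(\<Sum>n<N. card (verts (G n))) < m"
    by blast
  then have "{..<m} \<noteq> {}" by auto
  then obtain K where K: "fin_graph K" "verts K = {..<m}" "?X K \<le> ?a + C / real m"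
    using exists_graph_below_graphon[OF H W, of l "2 - l" "{..<m}"] l unfolding C_def by auto
  obtain n where n: "graph_iso (G n) K" and fin: "fin_graph (G n)"
    using G K(1) unfolding enumerates_finite_graphs_def by blast
  have card: "card (verts (G n)) = m"
    using n K(2) unfolding graph_iso_def by (auto dest: bij_betw_same_card)
  have "n \<ge> N"
  proof (rule ccontr)
    assume "\<not> n \<ge> N"
    then have "card (verts (G n)) \<le> (\<Sum>n<N. card (verts (G n)))" by (intro member_le_sum) auto
    then show False using card m(2) by simp
  qed
  moreover have "?X (G n) = ?X K"
    using hom_density_iso[OF H(1) fin K(1) n] graph_iso_complement[OF fin n]
      hom_density_iso[OF H(2) fin_graph_complement[OF fin] fin_graph_complement[OF K(1)]] by simp
  ultimately show False using N K(3) m(1) by force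
qed

text \<open>The step graphon of \<open>G n\<close> has an objective value at most that of
  \<open>G n\<close> plus an error that tends to 0.\<close>

lemma c_lam_ge:
  assumes H: "fin_graph H1" "fin_graph H2" and G: "enumerates_finite_graphs G"
    and l: "0 \<le> l" "l \<le> 2"
    and c: "\<And>W. graphon W \<Longrightarrow>
      c \<le> l * graphon_density H1 W + (2 - l) * graphon_density H2 (\<lambda>x y. 1 - W x y)"
  shows "ereal c \<le> c_lam G l H1 H2"
proof -
  let ?X = "\<lambda>K. l * hom_density H1 K + (2 - l) * hom_density H2 (complement K)"
  \<comment> \<open>Only \<open>H2\<close> contributes to the error, since the step graphon
    reproduces the density of \<open>H1\<close> exactly.\<close>
  define C where "C = (2 - l) * (real (card (verts H2)))\<^sup>2"
  have X_ge: "c - C / real (card (verts (G n))) \<le> ?X (G n)" for n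
  proof -
    have "fin_graph (G n)" using G by (simp add: enumerates_finite_graphs_def)
    from exists_step_graphon[OF this H] obtain W where W: "graphon W"
      "graphon_density H1 W = hom_density H1 (G n)"
      "graphon_density H2 (\<lambda>x y. 1 - W x y)
        \<le> hom_density H2 (complement (G n)) + (real (card (verts H2)))\<^sup>2 / real (card (verts (G n)))"
      by blast
    have "c \<le> l * hom_density H1 (G n) + (2 - l) * (hom_density H2 (complement (G n))
        + (real (card (verts H2)))\<^sup>2 / real (card (verts (G n))))"
      using c[OF W(1)] mult_left_mono[OF W(3), of "2 - l"] l W(2) by simp
    then show ?thesis by (simp add: C_def distrib_left)
  qed
  have "(\<lambda>n. c - C / real (card (verts (G n)))) \<longlonglongrightarrow> c - 0"
    by (intro tendsto_diff tendsto_const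
        filterlim_compose[OF lim_const_over_n enumerates_finite_graphs_card_at_top[OF G]])
  then have "liminf (\<lambda>n. ereal (c - C / real (card (verts (G n))))) = ereal c"
    by (intro lim_imp_Liminf) auto
  moreover have "liminf (\<lambda>n. ereal (c - C / real (card (verts (G n))))) \<le> c_lam G l H1 H2"
    unfolding c_lam_def using X_ge by (intro Liminf_mono) auto
  ultimately show ?thesis by simp
qed

text \<open>Almost optimal parameters have a convergent subsequence in the compact interval. For
  each fixed graphon the upper bound from \<open>c_lam_le\<close> is affine in the parameter, so the
  inequality passes to the limit.\<close>

lemma c_sup_attained:
  assumes H: "fin_graph H1" "fin_graph H2" and G: "enumerates_finite_graphs G"
    and c: "ereal c \<le> c_sup G H1 H2"
  obtains l where "0 \<le> l" "l \<le> 2" "\<And>W. graphon W \<Longrightarrow>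
      c \<le> l * graphon_density H1 W + (2 - l) * graphon_density H2 (\<lambda>x y. 1 - W x y)"
proof -
  have "\<exists>l\<in>{0..2}. ereal (c - 1 / real (Suc k)) < c_lam G l H1 H2" for k
  proof -
    have "ereal (c - 1 / real (Suc k)) < ereal c" by simp
    also note c
    finally show ?thesis unfolding c_sup_def less_SUP_iff .
  qed
  then obtain L where L: "\<And>k. L k \<in> {0..2}"
    and cL: "\<And>k. ereal (c - 1 / real (Suc k)) < c_lam G (L k) H1 H2" by metis
  obtain l r where l: "l \<in> {0..2}" and r: "strict_mono r" "(L \<circ> r) \<longlonglongrightarrow> l"
    using compact_Icc[of "0 :: real" 2] L unfolding compact_def by metis
  show thesis
  proof (rule that[of l])
    show "0 \<le> l" "l \<le> 2" using l by auto
    fix W assume W: "graphon W"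
    let ?a = "graphon_density H1 W" and ?b = "graphon_density H2 (\<lambda>x y. 1 - W x y)"
    have "c - 1 / real (Suc (r k)) \<le> (L \<circ> r) k * ?a + (2 - (L \<circ> r) k) * ?b" for k
    proof -
      have "0 \<le> L (r k)" "L (r k) \<le> 2" using L[of "r k"] by auto
      from less_le_trans[OF cL c_lam_le[OF H G this W]] show ?thesis by simp
    qed
    moreover have "(\<lambda>k. c - 1 / real (Suc (r k))) \<longlonglongrightarrow> c - 0"
      by (intro tendsto_diff tendsto_const
          LIMSEQ_subseq_LIMSEQ[OF LIMSEQ_Suc[OF lim_1_over_n] r(1), unfolded comp_def])
    moreover have "(\<lambda>k. (L \<circ> r) k * ?a + (2 - (L \<circ> r) k) * ?b) \<longlonglongrightarrow> l * ?a + (2 - l) * ?b"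
      by (intro tendsto_intros r(2))
    ultimately show "c \<le> l * ?a + (2 - l) * ?b" using LIMSEQ_le by fastforce
  qed
qed

section \<open>The upper bound and the case of equality\<close>

theorem theorem4p2:
  fixes H1 :: "'a ugraph" and H2 :: "'b ugraph" and G :: "nat \<Rightarrow> nat ugraph" and p :: real
  assumes "fin_graph H1" and "fin_graph H2"
    and "num_edges H1 \<ge> 1" and "num_edges H2 \<ge> 1"
    and "enumerates_finite_graphs G"
    and "0 < p" and "p < 1"
    and "p ^ num_edges H1 = (1 - p) ^ num_edges H2"
  shows "c_sup G H1 H2 \<le> ereal (2 * p ^ num_edges H1) \<and>
         2 * p ^ num_edges H1 = 2 * (1 - p) ^ num_edges H2 \<and>
         (c_sup G H1 H2 = ereal (2 * p ^ num_edges H1) \<longleftrightarrow> common p H1 H2)"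
proof -
  note H = assms(1,2) and G = assms(5) and p = assms(6,7) and pq = assms(8)
  define m1 where "m1 = num_edges H1"
  define m2 where "m2 = num_edges H2"
  have m: "m1 \<ge> 1" "m2 \<ge> 1" using assms(3,4) by (simp_all add: m1_def m2_def)
  \<comment> \<open>\<open>A\<close> is the derivative of \<open>x ^ m1\<close> at \<open>p\<close>,
    and \<open>B\<close> that of \<open>- (1 - x) ^ m2\<close>; they are also the denominators in
    \<open>common\<close>.\<close>
  define A where "A = real m1 * p ^ (m1 - 1)"
  define B where "B = real m2 * (1 - p) ^ (m2 - 1)"
  have AB: "A > 0" "B > 0" using m p by (auto simp: A_def B_def)
  have pA: "p ^ m1 / A = p / real m1" and pB: "(1 - p) ^ m2 / B = (1 - p) / real m2"
    using m p by (simp_all add: A_def B_def power_eq_if[of _ m1] power_eq_if[of _ m2])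
  have q: "p ^ m1 = (1 - p) ^ m2" using pq by (simp add: m1_def m2_def)
  let ?d1 = "graphon_density H1" and ?d2 = "\<lambda>W. graphon_density H2 (\<lambda>x y. 1 - W x y)"
  have common_iff: "common p H1 H2 \<longleftrightarrow>
      (\<forall>W. graphon W \<longrightarrow> p ^ m1 / A + (1 - p) ^ m2 / B \<le> ?d1 W / A + ?d2 W / B)"
    unfolding common_def pA pB by (simp add: A_def B_def m1_def m2_def)
  \<comment> \<open>If \<open>l * A = (2 - l) * B\<close>, the inequality defining commonness is a rescaling of
    the inequality \<open>2 * p ^ m1 \<le> l * d1 W + (2 - l) * d2 W\<close>.\<close>
  have rescale: "2 * p ^ m1 \<le> l * a + (2 - l) * b \<longleftrightarrow> p ^ m1 / A + (1 - p) ^ m2 / B \<le> a / A + b / B"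
    if l: "l * A = (2 - l) * B" "0 \<le> l" "l \<le> 2" for l a b
  proof -
    define \<kappa> where "\<kappa> = l * A"
    \<comment> \<open>For \<open>l = 0\<close> the balance condition would read
      \<open>0 = 2 * B\<close>.\<close>
    have "l \<noteq> 0" using l(1) AB by auto
    then have "\<kappa> > 0" using l(2) AB by (simp add: \<kappa>_def)
    have eqs: "l * u = \<kappa> * (u / A)" "(2 - l) * u = \<kappa> * (u / B)" for u
      unfolding \<kappa>_def using AB by (simp, simp add: l(1))
    have "2 * p ^ m1 = l * p ^ m1 + (2 - l) * (1 - p) ^ m2" using q by (simp add: algebra_simps)
    then have 1: "2 * p ^ m1 = \<kappa> * (p ^ m1 / A + (1 - p) ^ m2 / B)"
      by (simp only: eqs distrib_left)
    have 2: "l * a + (2 - l) * b = \<kappa> * (a / A + b / B)"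
      by (simp only: eqs distrib_left)
    show ?thesis unfolding 1 2 using \<open>\<kappa> > 0\<close> by (rule mult_le_cancel_left_pos)
  qed
  have upper: "c_sup G H1 H2 \<le> ereal (2 * p ^ m1)"
    unfolding c_sup_def
  proof (rule SUP_least)
    fix l :: real assume "l \<in> {0..2}"
    then have "c_lam G l H1 H2 \<le> ereal (l * p ^ m1 + (2 - l) * (1 - p) ^ m2)"
      using c_lam_le[OF H G, of l "\<lambda>_ _. p"] graphon_const[of p] p
      by (simp add: graphon_density_const m1_def m2_def)
    also have "l * p ^ m1 + (2 - l) * (1 - p) ^ m2 = 2 * p ^ m1"
      unfolding q by (simp add: algebra_simps)
    finally show "c_lam G l H1 H2 \<le> ereal (2 * p ^ m1)" .
  qed
  have "c_sup G H1 H2 = ereal (2 * p ^ m1) \<longleftrightarrow> common p H1 H2"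
  proof
    assume "common p H1 H2"
    \<comment> \<open>The solution of the balance condition \<open>l * A = (2 - l) * B\<close>
      required by \<open>rescale\<close>.\<close>
    define l where "l = 2 * B / (A + B)"
    have l: "l * A = (2 - l) * B" "0 \<le> l" "l \<le> 2"
      using AB by (simp_all add: l_def field_simps)
    have "ereal (2 * p ^ m1) \<le> c_lam G l H1 H2"
      using \<open>common p H1 H2\<close> unfolding common_iff
      by (intro c_lam_ge H G l(2,3)) (simp only: rescale[OF l])
    also have "\<dots> \<le> c_sup G H1 H2"
      unfolding c_sup_def using l by (intro SUP_upper) auto
    finally show "c_sup G H1 H2 = ereal (2 * p ^ m1)" using upper by (rule antisym[rotated])
  next
    assume "c_sup G H1 H2 = ereal (2 * p ^ m1)"
    then obtain l where l: "0 \<le> l" "l \<le> 2"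
      and below: "\<And>W. graphon W \<Longrightarrow> 2 * p ^ m1 \<le> l * ?d1 W + (2 - l) * ?d2 W"
      using c_sup_attained[OF H G, of "2 * p ^ m1"] by auto
    \<comment> \<open>The objective along constant graphons; its minimum at \<open>p\<close> is
      interior, so its derivative vanishes there.\<close>
    define g where "g x = l * x ^ m1 + (2 - l) * (1 - x) ^ m2" for x :: real
    \<comment> \<open>The radius keeps \<open>x\<close> inside the unit interval, where the constant
      \<open>x\<close> is a graphon.\<close>
    have "g p \<le> g x" if "\<bar>p - x\<bar> < min p (1 - p)" for x
    proof -
      have "x \<in> {0..1}" using that by auto
      then have "2 * p ^ m1 \<le> g x"
        using below[OF graphon_const[of x]] by (simp add: graphon_density_const g_def m1_def m2_def)
      moreover have "g p = 2 * p ^ m1" unfolding g_def q[symmetric] by (simp add: algebra_simps)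
      ultimately show ?thesis by simp
    qed
    moreover have "(g has_real_derivative l * A - (2 - l) * B) (at p)"
      unfolding g_def A_def B_def by (auto intro!: derivative_eq_intros simp: algebra_simps)
    \<comment> \<open>Stationarity is exactly the balance condition under which
      \<open>rescale\<close> turns \<open>below\<close> into commonness.\<close>
    ultimately have "l * A - (2 - l) * B = 0"
      using p by (intro DERIV_local_min[of g _ p "min p (1 - p)"]) auto
    then show "common p H1 H2"
      unfolding common_iff using rescale[of l] below l by auto
  qed
  then show ?thesis using upper pq by (simp add: m1_def)
qed

end
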